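(* The spanning tree polytope $T_n$ fulfills the rhombus criterion.
   Context: $[n]=\{1,\dots,n\}$. For a tree $T=([n],E)$ on the vertex set $[n]$ define $v_T=\sum_{ij\in E}e_{ij}$, where $(e_{ij})$ is the standard basis of $\mathbb{R}^{\binom{[n]}{2}}$, indexed by the 2-element subsets of $[n]$. The spanning tree polytope is $T_n=\operatorname{conv}(v_T: T=([n],E)\text{ is a tree})$. A polytope $P$ with vertex set $V$ fulfills the rhombus criterion if for every pair of distinct vertices $\alpha,\beta\in V$, either $\operatorname{conv}(\alpha,\beta)$ is an edge (1-dimensional face) of $P$, or there exist $\alpha',\beta'\in V\setminus\{\alpha,\beta\}$ (called witnesses) with $\alpha+\beta=\alpha'+\beta'$. *)

theory Defs
  imports "HOL-Analysis.Analysis"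
begin

text \<open>
  A finite simple graph with vertex set the finite type \<open>'n\<close> (so that \<open>n = CARD('n)\<close> is an
  arbitrary positive number) is given by its edge set, a set of 2-element subsets of \<open>'n\<close>.
\<close>

definition simple_graph :: "'n set set \<Rightarrow> bool" where
  "simple_graph E \<longleftrightarrow> (\<forall>e\<in>E. card e = 2)"

definition connected_graph :: "'n set set \<Rightarrow> bool" where
  "connected_graph E \<longleftrightarrow> (\<forall>u v. (u, v) \<in> {(x, y). {x, y} \<in> E}\<^sup>*)"

definition is_cycle :: "'n set set \<Rightarrow> 'n list \<Rightarrow> bool" where
  "is_cycle E xs \<longleftrightarrow> length xs \<ge> 3 \<and> distinct xs \<and>
     (\<forall>i. Suc i < length xs \<longrightarrow> {xs ! i, xs ! Suc i} \<in> E) \<and> {last xs, hd xs} \<in> E"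

definition is_tree :: "'n set set \<Rightarrow> bool" where
  "is_tree E \<longleftrightarrow> simple_graph E \<and> connected_graph E \<and> (\<nexists>xs. is_cycle E xs)"

text \<open>
  The ambient space \<open>real ^ 'n set\<close> has one coordinate for every subset of \<open>'n\<close>, not just for
  the 2-element ones. Only the coordinates of 2-element subsets are ever nonzero on the
  vectors below, so everything happens in their coordinate subspace, and faces and affine
  dimensions do not depend on the surrounding space. A coordinate type of exactly the
  2-element subsets would be empty, hence not a type, for \<open>CARD('n) = 1\<close>.
\<close>

definition tree_vector :: "'n set set \<Rightarrow> real ^ ('n::finite set)" where
  "tree_vector E = (\<Sum>e\<in>E. axis e 1)"

definition spanning_tree_polytope :: "(real ^ ('n::finite set)) set" where
  "spanning_tree_polytope = convex hull {tree_vector E | E. is_tree E}"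

definition polytope_vertices :: "'a::euclidean_space set \<Rightarrow> 'a set" where
  "polytope_vertices P = {v. v extreme_point_of P}"

definition rhombus_criterion :: "'a::euclidean_space set \<Rightarrow> bool" where
  "rhombus_criterion P \<longleftrightarrow> polytope P \<and>
     (\<forall>\<alpha>\<in>polytope_vertices P. \<forall>\<beta>\<in>polytope_vertices P. \<alpha> \<noteq> \<beta> \<longrightarrow>
        (convex hull {\<alpha>, \<beta>}) edge_of P \<or>
        (\<exists>\<alpha>'\<in>polytope_vertices P - {\<alpha>, \<beta>}. \<exists>\<beta>'\<in>polytope_vertices P - {\<alpha>, \<beta>}.
           \<alpha> + \<beta> = \<alpha>' + \<beta>'))"

end

theory Submission
  imports Defs
begin

text \<open>
  All trees on the vertex set have equally many edges, so an incidence vector with the right number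
  of ones has a strictly larger inner product with itself than with any other such vector. Hence
  every \<open>tree_vector A\<close> is a vertex, and if \<open>A\<close> and \<open>B\<close> differ by the exchange of one edge, the
  functional \<open>tree_vector A + tree_vector B\<close> exposes the segment between them.
  If \<open>A\<close> and \<open>B\<close> differ in at least two edges, symmetric basis exchange in the graphic matroid
  yields trees \<open>A - {e} \<union> {f}\<close> and \<open>B - {f} \<union> {e}\<close>, which are the witnesses.
\<close>

section \<open>Connectivity\<close>

definition adj :: "'n set set \<Rightarrow> ('n \<times> 'n) set" where
  "adj E = {(x, y). {x, y} \<in> E}"

lemma connected_graph_adj: "connected_graph E \<longleftrightarrow> (\<forall>u v. (u, v) \<in> (adj E)\<^sup>*)"
  by (simp add: connected_graph_def adj_def)

lemma sym_adj: "sym (adj E)"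
  by (auto simp: sym_def adj_def insert_commute)

lemma reach_sym: "(x, y) \<in> (adj E)\<^sup>* \<Longrightarrow> (y, x) \<in> (adj E)\<^sup>*"
  using sym_rtrancl[OF sym_adj] by (metis symD)

lemma reach_mono: "(x, y) \<in> (adj E)\<^sup>* \<Longrightarrow> E \<subseteq> F \<Longrightarrow> (x, y) \<in> (adj F)\<^sup>*"
  by (rule subsetD[OF rtrancl_mono]) (auto simp: adj_def)

text \<open>Any use of the deleted edge, in either direction, can be replaced by the assumed detour
  between its ends.\<close>

lemma connected_delete_edge:
  assumes "connected_graph E" and uv: "(u, v) \<in> (adj (E - {{u, v}}))\<^sup>*"
  shows "connected_graph (E - {{u, v}})"
proof -
  have "adj E \<subseteq> (adj (E - {{u, v}}))\<^sup>*"
  proof clarify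
    fix x y assume "(x, y) \<in> adj E"
    then show "(x, y) \<in> (adj (E - {{u, v}}))\<^sup>*"
      using uv reach_sym[OF uv] by (cases "{x, y} = {u, v}") (auto simp: adj_def doubleton_eq_iff)
  qed
  then have "(adj E)\<^sup>* \<subseteq> (adj (E - {{u, v}}))\<^sup>*"
    by (rule rtrancl_subset_rtrancl)
  with assms(1) show ?thesis by (auto simp: connected_graph_adj)
qed

text \<open>Follow a walk from \<open>u\<close>: a step over another edge stays in the current
  component, and a step over \<open>{u, v}\<close> lands on \<open>u\<close> or \<open>v\<close>
  itself.\<close>

lemma delete_edge_components:
  assumes "connected_graph E"
  shows "(u, y) \<in> (adj (E - {{u, v}}))\<^sup>* \<or> (v, y) \<in> (adj (E - {{u, v}}))\<^sup>*"
proof -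
  have "(u, y) \<in> (adj E)\<^sup>*" using assms by (simp add: connected_graph_adj)
  then show ?thesis
  proof (induction rule: rtrancl_induct)
    case (step y z)
    show ?case
    proof (cases "{y, z} = {u, v}")
      case True
      then show ?thesis by (auto simp: doubleton_eq_iff)
    next
      case False
      then have "(y, z) \<in> adj (E - {{u, v}})" using step.hyps by (auto simp: adj_def)
      then show ?thesis using step.IH by (meson rtrancl.rtrancl_into_rtrancl)
    qed
  qed simp
qed

text \<open>The path grows edge by edge; when the next vertex already lies on it, the path is cut
  back to that vertex. Vertex lists are the format that \<open>is_cycle\<close> expects.\<close>

lemma simple_path_exists:
  assumes "(u, v) \<in> (adj E)\<^sup>*"
  obtains xs where "xs \<noteq> []" "distinct xs" "hd xs = u" "last xs = v"
    "\<And>i. Suc i < length xs \<Longrightarrow> {xs ! i, xs ! Suc i} \<in> E"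
proof -
  have "\<exists>xs. xs \<noteq> [] \<and> distinct xs \<and> hd xs = u \<and> last xs = v \<and>
      (\<forall>i. Suc i < length xs \<longrightarrow> {xs ! i, xs ! Suc i} \<in> E)"
    using assms
  proof (induction rule: rtrancl_induct)
    case base
    show ?case by (rule exI[of _ "[u]"]) simp
  next
    case (step y z)
    then obtain xs where xs: "xs \<noteq> []" "distinct xs" "hd xs = u" "last xs = y"
      "\<forall>i. Suc i < length xs \<longrightarrow> {xs ! i, xs ! Suc i} \<in> E" by blast
    show ?case
    proof (cases "z \<in> set xs")
      case True
      then obtain j where j: "j < length xs" "xs ! j = z" by (auto simp: in_set_conv_nth)
      then have "last (take (Suc j) xs) = z" by (simp add: take_Suc_conv_app_nth)
      then show ?thesis
        using xs j(1) by (intro exI[of _ "take (Suc j) xs"]) simp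
    next
      case False
      have yz: "{y, z} \<in> E" using step.hyps by (simp add: adj_def)
      have "{(xs @ [z]) ! i, (xs @ [z]) ! Suc i} \<in> E" if "Suc i < length (xs @ [z])" for i
      proof (cases "Suc i < length xs")
        case True
        then show ?thesis using xs by (simp add: nth_append)
      next
        case False
        with that have "Suc i = length xs" by simp
        then show ?thesis using xs yz
          by (metis last_conv_nth diff_Suc_1 lessI nth_append nth_append_length)
      qed
      with xs False show ?thesis by (intro exI[of _ "xs @ [z]"]) auto
    qed
  qed
  with that show thesis by blast
qed

text \<open>Only the edges between positions \<open>a\<close> and \<open>b\<close> are required, so
  this applies to a piece of a path that avoids a deleted edge.\<close>

lemma reach_along:
  assumes "a \<le> b" "\<And>k. a \<le> k \<Longrightarrow> k < b \<Longrightarrow> {xs ! k, xs ! Suc k} \<in> E"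
  shows "(xs ! a, xs ! b) \<in> (adj E)\<^sup>*"
  using assms
proof (induction b rule: dec_induct)
  case (step m)
  then have "(xs ! m, xs ! Suc m) \<in> adj E" by (simp add: adj_def)
  with step show ?case by (meson less_SucI rtrancl.rtrancl_into_rtrancl)
qed simp

text \<open>A match in reversed order would need both \<open>i = Suc j\<close> and
  \<open>j = Suc i\<close>. Hence deleting one edge of a simple path leaves the others
  intact.\<close>

lemma distinct_consecutive_eq:
  assumes "distinct xs" "Suc i < length xs" "Suc j < length xs"
    "{xs ! i, xs ! Suc i} = {xs ! j, xs ! Suc j}"
  shows "i = j"
proof -
  have "i < length xs" "j < length xs" using assms(2,3) by auto
  with assms show ?thesis by (auto simp: doubleton_eq_iff nth_eq_iff_index_eq)
qed

text \<open>Every vertex other than the root picks an edge to a vertex closer to the root.\<close>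

lemma connected_spanning_subgraph:
  fixes E :: "'n::finite set set"
  assumes "connected_graph E"
  obtains F where "F \<subseteq> E" "connected_graph F" "Suc (card F) = CARD('n)"
proof -
  \<comment> \<open>The root is an arbitrary fixed vertex, and \<open>d\<close> is the distance from
    it; connectedness makes the \<open>LEAST\<close> well defined.\<close>
  define r :: 'n where "r = undefined"
  define d where "d v = (LEAST k. (r, v) \<in> adj E ^^ k)" for v
  have d: "(r, v) \<in> adj E ^^ d v" for v
    unfolding d_def using assms
    by (metis LeastI_ex connected_graph_adj rtrancl_power)
  have d_le: "d v \<le> k" if "(r, v) \<in> adj E ^^ k" for v k
    unfolding d_def using that by (rule Least_le)
  \<comment> \<open>The last vertex before \<open>v\<close> on a shortest walk from the root serves
    as \<open>p\<close>.\<close>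
  have "\<exists>p. {v, p} \<in> E \<and> d p < d v" if "v \<noteq> r" for v
  proof (cases "d v")
    case 0
    then show ?thesis using d[of v] that by simp
  next
    case (Suc k)
    then obtain z where "(r, z) \<in> adj E ^^ k" "(z, v) \<in> adj E"
      using d[of v] by auto
    then show ?thesis using Suc d_le[of z k] by (auto simp: adj_def insert_commute)
  qed
  then obtain p where p: "\<And>v. v \<noteq> r \<Longrightarrow> {v, p v} \<in> E \<and> d (p v) < d v" by metis
  define F where "F = (\<lambda>v. {v, p v}) ` (- {r})"
  have inj: "inj_on (\<lambda>v. {v, p v}) (- {r})"
  proof (rule inj_onI)
    fix v w assume *: "v \<in> - {r}" "w \<in> - {r}" "{v, p v} = {w, p w}"
    show "v = w"
    proof (rule ccontr)
      assume "v \<noteq> w"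
      \<comment> \<open>Distinct vertices picking the same edge would be each other's parents, each
        strictly closer to the root than the other.\<close>
      with *(3) have eq: "p w = v" "p v = w" by (auto simp: doubleton_eq_iff)
      have "d (p v) < d v" "d (p w) < d w" using p *(1,2) by auto
      then show False unfolding eq by simp
    qed
  qed
  have "(v, r) \<in> (adj F)\<^sup>*" for v
  proof (induction v rule: measure_induct_rule[of d])
    case (less v)
    show ?case
    proof (cases "v = r")
      case False
      then have "(v, p v) \<in> adj F" by (auto simp: adj_def F_def)
      moreover have "(p v, r) \<in> (adj F)\<^sup>*" using p[OF False] less by blast
      ultimately show ?thesis by (rule converse_rtrancl_into_rtrancl)
    qed simp
  qed
  then have "connected_graph F"
    unfolding connected_graph_adj by (meson reach_sym rtrancl_trans)
  moreover have "Suc (card F) = CARD('n)"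
  proof -
    have "card F = CARD('n) - 1"
      unfolding F_def card_image[OF inj] by (simp add: Compl_eq_Diff_UNIV card_Diff_singleton)
    moreover have "CARD('n) > 0" by simp
    ultimately show ?thesis by linarith
  qed
  moreover have "F \<subseteq> E" using p by (auto simp: F_def)
  ultimately show thesis using that by blast
qed

lemma connected_graph_card:
  fixes E :: "'n::finite set set"
  assumes "connected_graph E"
  shows "CARD('n) \<le> Suc (card E)"
  using connected_spanning_subgraph[OF assms] by (metis Suc_le_mono card_mono finite)

section \<open>Trees and symmetric exchange\<close>

text \<open>A path joining the ends of \<open>e\<close> without \<open>e\<close> would close up with
  \<open>e\<close> to a cycle.\<close>

lemma tree_delete_edge:
  assumes "is_tree E" "e \<in> E"
  shows "\<not> connected_graph (E - {e})"
proof
  assume conn: "connected_graph (E - {e})"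
  from assms obtain u v where e: "e = {u, v}" "u \<noteq> v"
    by (auto simp: is_tree_def simple_graph_def card_2_iff)
  have "(u, v) \<in> (adj (E - {e}))\<^sup>*" using conn by (simp add: connected_graph_adj)
  then obtain xs where xs: "xs \<noteq> []" "distinct xs" "hd xs = u" "last xs = v"
    "\<And>i. Suc i < length xs \<Longrightarrow> {xs ! i, xs ! Suc i} \<in> E - {e}"
    by (metis simple_path_exists)
  \<comment> \<open>Length 1 would identify the two ends of \<open>e\<close>; length 2 would make
    the path the deleted edge itself.\<close>
  have "length xs \<noteq> 1" using xs e by (auto simp: length_Suc_conv)
  moreover have "length xs \<noteq> 2"
    using xs(3,4) xs(5)[of 0] e(1) by (auto simp: length_Suc_conv numeral_2_eq_2)
  ultimately have "length xs \<ge> 3" using xs(1) by (cases "length xs") auto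
  then have "is_cycle E xs"
    using xs e assms(2) by (auto simp: is_cycle_def insert_commute)
  with assms(1) show False by (auto simp: is_tree_def)
qed

text \<open>The rest of the cycle is a detour around its closing edge.\<close>

lemma cycle_delete_edge:
  assumes "connected_graph E" "is_cycle E xs"
  shows "connected_graph (E - {{hd xs, last xs}})"
proof (rule connected_delete_edge[OF assms(1)])
  let ?l = "length xs - 1"
  have xs: "length xs \<ge> 3" "distinct xs" "\<And>i. Suc i < length xs \<Longrightarrow> {xs ! i, xs ! Suc i} \<in> E"
    using assms(2) by (auto simp: is_cycle_def)
  have "xs \<noteq> []" using xs(1) by auto
  then have ends: "hd xs = xs ! 0" "last xs = xs ! ?l"
    by (simp_all add: hd_conv_nth last_conv_nth)
  have "(xs ! 0, xs ! ?l) \<in> (adj (E - {{hd xs, last xs}}))\<^sup>*"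
  proof (rule reach_along)
    fix k assume "k < ?l"
    then have k: "Suc k < length xs" by simp
    \<comment> \<open>Equality would force a list of length 2, but a cycle has at least three
      vertices.\<close>
    have "{xs ! k, xs ! Suc k} \<noteq> {xs ! 0, xs ! ?l}"
      using k xs(1,2) \<open>xs \<noteq> []\<close> by (auto simp: doubleton_eq_iff nth_eq_iff_index_eq)
    with xs(3)[OF k] show "{xs ! k, xs ! Suc k} \<in> E - {{hd xs, last xs}}" by (simp add: ends)
  qed simp
  then show "(hd xs, last xs) \<in> (adj (E - {{hd xs, last xs}}))\<^sup>*" by (simp add: ends)
qed

text \<open>A spanning connected subgraph with n - 1 edges cannot be proper in a tree, which loses
  connectedness with any edge. Conversely, dropping an edge of a cycle would leave a connected graph
  with too few edges.\<close>

lemma is_tree_iff_card: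
  fixes E :: "'n::finite set set"
  shows "is_tree E \<longleftrightarrow> simple_graph E \<and> connected_graph E \<and> Suc (card E) = CARD('n)"
proof
  assume E: "is_tree E"
  then have conn: "connected_graph E" by (simp add: is_tree_def)
  then obtain F where F: "F \<subseteq> E" "connected_graph F" "Suc (card F) = CARD('n)"
    by (rule connected_spanning_subgraph)
  have "F = E"
  proof (rule ccontr)
    assume "F \<noteq> E"
    then obtain e where "e \<in> E" "F \<subseteq> E - {e}" using F(1) by blast
    with F(2) have "connected_graph (E - {e})"
      unfolding connected_graph_adj by (meson reach_mono)
    with tree_delete_edge[OF E \<open>e \<in> E\<close>] show False by simp
  qed
  with E F show "simple_graph E \<and> connected_graph E \<and> Suc (card E) = CARD('n)"
    by (simp add: is_tree_def)
next
  assume E: "simple_graph E \<and> connected_graph E \<and> Suc (card E) = CARD('n)"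
  have "\<not> is_cycle E xs" for xs
  proof
    assume c: "is_cycle E xs"
    then have "{hd xs, last xs} \<in> E" by (simp add: is_cycle_def insert_commute)
    then have "card (E - {{hd xs, last xs}}) < card E" by (intro card_Diff1_less) auto
    with connected_graph_card[OF cycle_delete_edge[OF _ c]] E show False by simp
  qed
  with E show "is_tree E" by (simp add: is_tree_def)
qed

text \<open>The swap preserves the number of edges, so connectedness alone rules out cycles.\<close>

lemma is_tree_swap:
  fixes E :: "'n::finite set set"
  assumes "is_tree E" "e \<in> E" "f \<notin> E" "card f = 2" "connected_graph (insert f (E - {e}))"
  shows "is_tree (insert f (E - {e}))"
proof -
  have "card (insert f (E - {e})) = card E"
    using assms(2,3) card_Suc_Diff1[of E e] by simp
  with assms show ?thesis by (auto simp: is_tree_iff_card simple_graph_def)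
qed

text \<open>Deleting \<open>e\<close> splits \<open>A\<close> into two sides. The path in
  \<open>B\<close> between the ends of \<open>e\<close> crosses from one side to the other at some
  edge \<open>f\<close>. This \<open>f\<close> reconnects the sides, and it lies on the cycle that
  \<open>e\<close> closes in \<open>B\<close>, so the same \<open>f\<close> serves both
  swaps.\<close>

lemma tree_symmetric_exchange:
  fixes A B :: "'n::finite set set"
  assumes A: "is_tree A" and B: "is_tree B" and e: "e \<in> A" "e \<notin> B"
  obtains f where "f \<in> B" "f \<notin> A" "is_tree (insert f (A - {e}))" "is_tree (insert e (B - {f}))"
proof -
  from A e obtain u v where uv: "e = {u, v}"
    by (auto simp: is_tree_def simple_graph_def card_2_iff)
  have connA: "connected_graph A" and connB: "connected_graph B"
    using A B by (simp_all add: is_tree_def)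
  define U where "U = {x. (u, x) \<in> (adj (A - {e}))\<^sup>*}"
  have "u \<in> U" by (simp add: U_def)
  have "v \<notin> U"
    using connected_delete_edge[OF connA] tree_delete_edge[OF A e(1)] by (auto simp: U_def uv)
  have "(u, v) \<in> (adj B)\<^sup>*" using connB by (simp add: connected_graph_adj)
  then obtain xs where xs: "xs \<noteq> []" "distinct xs" "hd xs = u" "last xs = v"
    "\<And>i. Suc i < length xs \<Longrightarrow> {xs ! i, xs ! Suc i} \<in> B"
    by (metis simple_path_exists)
  let ?l = "length xs - 1"
  have ends: "xs ! 0 = u" "xs ! ?l = v"
    using xs(1,3,4) by (simp_all add: hd_conv_nth last_conv_nth)
  have "\<exists>i<?l. xs ! i \<in> U \<and> xs ! Suc i \<notin> U"
  proof (rule ccontr)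
    assume *: "\<not> ?thesis"
    have "j \<le> ?l \<Longrightarrow> xs ! j \<in> U" for j
      by (induction j) (use * ends \<open>u \<in> U\<close> in auto)
    with ends \<open>v \<notin> U\<close> show False by auto
  qed
  then obtain i where i: "i < ?l" "xs ! i \<in> U" "xs ! Suc i \<notin> U" by blast
  define x y f where "x = xs ! i" and "y = xs ! Suc i" and "f = {x, y}"
  have "Suc i < length xs" using i(1) by simp
  then have "f \<in> B" using xs(5) by (simp add: f_def x_def y_def)
  have "f \<noteq> e" using \<open>f \<in> B\<close> e(2) by auto
  have "f \<notin> A"
  proof
    assume "f \<in> A"
    then have "(x, y) \<in> adj (A - {e})" using \<open>f \<noteq> e\<close> by (simp add: adj_def f_def)
    then have "y \<in> U" using i(2) by (auto simp: U_def x_def intro: rtrancl_into_rtrancl)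
    with i(3) show False by (simp add: y_def)
  qed
  have "connected_graph (insert f (A - {e}))"
  proof -
    \<comment> \<open>Deletion from \<open>insert f A\<close> is the form needed for
      \<open>connected_delete_edge\<close>. The detour around \<open>e\<close> runs from
      \<open>u\<close> to \<open>x\<close> inside \<open>U\<close>, over \<open>f\<close> to
      \<open>y\<close>, and on to \<open>v\<close> on the other side.\<close>
    let ?G = "insert f A - {e}"
    have G: "?G = insert f (A - {e})" using \<open>f \<noteq> e\<close> by auto
    have "(u, x) \<in> (adj (A - {e}))\<^sup>*" using i(2) by (simp add: U_def x_def)
    then have ux: "(u, x) \<in> (adj ?G)\<^sup>*" by (rule reach_mono) auto
    have "(v, y) \<in> (adj (A - {e}))\<^sup>*"
      using delete_edge_components[OF connA, of u y v] i(3) by (simp add: U_def y_def uv)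
    then have "(v, y) \<in> (adj ?G)\<^sup>*" by (rule reach_mono) auto
    then have yv: "(y, v) \<in> (adj ?G)\<^sup>*" by (rule reach_sym)
    have "(x, y) \<in> adj ?G" using \<open>f \<noteq> e\<close> by (simp add: adj_def f_def)
    with ux yv have "(u, v) \<in> (adj ?G)\<^sup>*" by (meson rtrancl_into_rtrancl rtrancl_trans)
    moreover have "connected_graph (insert f A)"
      using connA unfolding connected_graph_adj by (meson reach_mono subset_insertI)
    ultimately show ?thesis using connected_delete_edge[of "insert f A" u v, folded uv] by (simp add: G)
  qed
  moreover have "connected_graph (insert e (B - {f}))"
  proof -
    let ?G = "insert e B - {f}"
    have G: "?G = insert e (B - {f})" using \<open>f \<noteq> e\<close> by auto
    have off: "{xs ! k, xs ! Suc k} \<in> ?G" if "Suc k < length xs" "k \<noteq> i" for k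
      using that distinct_consecutive_eq[OF xs(2) that(1) \<open>Suc i < length xs\<close>] xs(5)[OF that(1)]
      by (auto simp: f_def x_def y_def)
    \<comment> \<open>The detour around \<open>f\<close> runs from \<open>x\<close> back along the
      path to \<open>u\<close>, over \<open>e\<close> to \<open>v\<close>, and back along the path
      to \<open>y\<close>.\<close>
    have "(xs ! 0, x) \<in> (adj ?G)\<^sup>*"
      unfolding x_def using i(1) by (intro reach_along off) auto
    moreover have "(y, xs ! ?l) \<in> (adj ?G)\<^sup>*"
      unfolding y_def using i(1) by (intro reach_along off) auto
    moreover have "(u, v) \<in> adj ?G" using \<open>f \<noteq> e\<close> by (simp add: adj_def uv)
    ultimately have "(x, y) \<in> (adj ?G)\<^sup>*"
      unfolding ends by (meson reach_sym rtrancl_into_rtrancl rtrancl_trans)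
    moreover have "connected_graph (insert e B)"
      using connB unfolding connected_graph_adj by (meson reach_mono subset_insertI)
    ultimately show ?thesis using connected_delete_edge[of "insert e B" x y, folded f_def] by (simp add: G)
  qed
  moreover have "card e = 2" "card f = 2"
    using A B e(1) \<open>f \<in> B\<close> by (auto simp: is_tree_def simple_graph_def)
  ultimately show thesis
    using that \<open>f \<in> B\<close> \<open>f \<notin> A\<close> is_tree_swap A B e by blast
qed

section \<open>Faces of the polytope\<close>

lemma inner_tree_vector: "tree_vector A \<bullet> tree_vector B = real (card (A \<inter> B))"
proof -
  have "tree_vector A \<bullet> tree_vector B = (\<Sum>f\<in>B. \<Sum>e\<in>A. if e = f then 1 else 0)"
    unfolding tree_vector_def inner_sum_left inner_sum_right
    by (intro sum.cong refl) (simp add: inner_axis_axis)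
  also have "\<dots> = (\<Sum>f\<in>B. if f \<in> A then 1 else 0)"
    by (intro sum.cong) auto
  also have "\<dots> = real (card (A \<inter> B))"
    by (simp add: sum.If_cases Int_commute)
  finally show ?thesis .
qed

lemma tree_vector_eq_iff: "tree_vector A = tree_vector B \<longleftrightarrow> A = B"
proof
  have "tree_vector E \<bullet> axis e 1 = (if e \<in> E then 1 else 0 :: real)" for E and e :: "'a set"
    unfolding tree_vector_def inner_sum_left by (simp add: inner_axis_axis)
  then show "A = B" if "tree_vector A = tree_vector B"
    using that by (metis set_eqI zero_neq_one)
qed simp

text \<open>\<open>e\<close> and \<open>f\<close> merely trade places, so each edge keeps its total
  multiplicity in the two sets.\<close>

lemma tree_vector_swap_sum:
  assumes "e \<in> A" "e \<notin> B" "f \<in> B" "f \<notin> A"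
  shows "tree_vector A + tree_vector B
    = tree_vector (insert f (A - {e})) + tree_vector (insert e (B - {f}))"
  using assms unfolding tree_vector_def
  by (simp add: sum.remove[of A e] sum.remove[of B f])

text \<open>The affine hull of \<open>T\<close> stays in the hyperplane, while the hull of the
  remaining points lies strictly below it; this disjointness is the criterion for a face.\<close>

lemma hyperplane_face_of_convex_hull:
  fixes S :: "'a::euclidean_space set"
  assumes "finite S" "T \<subseteq> S" "\<And>x. x \<in> T \<Longrightarrow> a \<bullet> x = b" "\<And>x. x \<in> S - T \<Longrightarrow> a \<bullet> x < b"
  shows "(convex hull T) face_of (convex hull S)"
proof (rule face_of_convex_hulls[OF assms(1,2)])
  have "affine hull T \<subseteq> {x. a \<bullet> x = b}"
    by (rule hull_minimal) (use assms(3) in \<open>auto simp: affine_hyperplane\<close>)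
  moreover have "convex hull (S - T) \<subseteq> {x. a \<bullet> x < b}"
    by (rule hull_minimal) (use assms(4) in \<open>auto simp: convex_halfspace_lt\<close>)
  ultimately show "affine hull T \<inter> convex hull (S - T) = {}" by fastforce
qed

text \<open>Equal cardinality prevents \<open>A\<close> from lying inside a different
  \<open>T\<close>. This gives the strict inequalities for vertices and edges of the
  polytope.\<close>

lemma card_Int_less:
  assumes "finite A" "finite T" "card T = card A" "T \<noteq> A"
  shows "card (A \<inter> T) < card A"
proof (rule psubset_card_mono[OF assms(1)])
  show "A \<inter> T \<subset> A" using assms card_subset_eq[of T A] by auto
qed

lemma finite_tree_vectors: "finite {tree_vector E | E. is_tree E}"
  by (rule finite_subset[of _ "range tree_vector"]) auto

lemma card_tree_eq:
  fixes A T :: "'n::finite set set"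
  shows "is_tree A \<Longrightarrow> is_tree T \<Longrightarrow> card T = card A"
  by (simp add: is_tree_iff_card)

lemma polytope_vertices_spanning_tree:
  "polytope_vertices spanning_tree_polytope = {tree_vector E | E. is_tree E}" (is "_ = ?S")
proof
  show "polytope_vertices spanning_tree_polytope \<subseteq> ?S"
    unfolding polytope_vertices_def spanning_tree_polytope_def
    by (auto dest: extreme_point_of_convex_hull)
  have "tree_vector A extreme_point_of (convex hull ?S)" if A: "is_tree A" for A
  proof -
    have "(convex hull {tree_vector A}) face_of (convex hull ?S)"
    proof (rule hyperplane_face_of_convex_hull[OF finite_tree_vectors])
      fix x assume "x \<in> ?S - {tree_vector A}"
      then obtain T where T: "x = tree_vector T" "is_tree T" "T \<noteq> A" by auto
      then show "tree_vector A \<bullet> x < card A"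
        using card_Int_less[of A T] card_tree_eq[OF A] by (simp add: inner_tree_vector)
    qed (use A in \<open>auto simp: inner_tree_vector\<close>)
    then show ?thesis by (simp add: face_of_singleton)
  qed
  then show "?S \<subseteq> polytope_vertices spanning_tree_polytope"
    by (auto simp: polytope_vertices_def spanning_tree_polytope_def)
qed

lemma adjacent_trees_edge:
  assumes A: "is_tree A" and B: "is_tree B" and card: "card (A - B) = 1"
  shows "(convex hull {tree_vector A, tree_vector B}) edge_of spanning_tree_polytope"
proof -
  have "A \<noteq> B" using card by auto
  have AB: "card A = card (A \<inter> B) + 1" using card card_Int_Diff[of A B] by simp
  let ?S = "{tree_vector E | E. is_tree E}"
  have "(convex hull {tree_vector A, tree_vector B}) face_of (convex hull ?S)"
  proof (rule hyperplane_face_of_convex_hull[OF finite_tree_vectors])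
    \<comment> \<open>Since \<open>A\<close> and \<open>B\<close> share all but one edge, this value
      is \<open>2 * card A - 1\<close>. Any other tree shares at most \<open>card A - 1\<close>
      edges with each of them, so it reaches at most \<open>2 * card A - 2\<close>.\<close>
    let ?b = "real (card A + card (A \<inter> B))"
    show "{tree_vector A, tree_vector B} \<subseteq> ?S" using A B by auto
    show "(tree_vector A + tree_vector B) \<bullet> x = ?b" if "x \<in> {tree_vector A, tree_vector B}" for x
      using that card_tree_eq[OF A B] by (auto simp: inner_add_left inner_tree_vector Int_commute)
    fix x assume "x \<in> ?S - {tree_vector A, tree_vector B}"
    then obtain T where T: "x = tree_vector T" "is_tree T" "T \<noteq> A" "T \<noteq> B" by auto
    have "card (A \<inter> T) < card A" "card (B \<inter> T) < card A"
      using T card_Int_less[of A T] card_Int_less[of B T] card_tree_eq[OF A] card_tree_eq[OF A B]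
      by auto
    then show "(tree_vector A + tree_vector B) \<bullet> x < ?b"
      using T(1) AB by (simp add: inner_add_left inner_tree_vector)
  qed
  moreover have "aff_dim (convex hull {tree_vector A, tree_vector B}) = 1"
    using \<open>A \<noteq> B\<close> by (simp add: aff_dim_convex_hull aff_dim_2 tree_vector_eq_iff)
  ultimately show ?thesis by (simp add: edge_of_def spanning_tree_polytope_def)
qed

theorem proposition2p2:
  "rhombus_criterion (spanning_tree_polytope :: (real ^ ('n::finite set)) set)"
proof -
  let ?P = "spanning_tree_polytope :: (real ^ ('n set)) set"
  have "(convex hull {\<alpha>, \<beta>}) edge_of ?P \<or>
      (\<exists>\<alpha>'\<in>polytope_vertices ?P - {\<alpha>, \<beta>}. \<exists>\<beta>'\<in>polytope_vertices ?P - {\<alpha>, \<beta>}. \<alpha> + \<beta> = \<alpha>' + \<beta>')"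
    if "\<alpha> \<in> polytope_vertices ?P" "\<beta> \<in> polytope_vertices ?P" "\<alpha> \<noteq> \<beta>" for \<alpha> \<beta>
  proof -
    from that obtain A B where A: "is_tree A" "\<alpha> = tree_vector A"
      and B: "is_tree B" "\<beta> = tree_vector B" and "A \<noteq> B"
      by (auto simp: polytope_vertices_spanning_tree)
    show ?thesis
    proof (cases "card (A - B) = 1")
      case True
      with A B adjacent_trees_edge show ?thesis by blast
    next
      case False
      have "\<not> A \<subseteq> B" using \<open>A \<noteq> B\<close> card_tree_eq[OF A(1) B(1)] card_subset_eq[of B A] by auto
      then obtain e where e: "e \<in> A" "e \<notin> B" by blast
      then obtain f where f: "f \<in> B" "f \<notin> A"
        and trees: "is_tree (insert f (A - {e}))" "is_tree (insert e (B - {f}))"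
        using tree_symmetric_exchange A(1) B(1) by metis
      have "A - B \<noteq> {e}" using False by auto
      \<comment> \<open>A second edge \<open>g\<close> of \<open>A - B\<close> exists because the
        difference is not just \<open>e\<close>. It tells the first new tree from \<open>B\<close>
        and the second from \<open>A\<close>; the swapped edges handle the other two
        comparisons.\<close>
      with e obtain g where g: "g \<in> A" "g \<notin> B" "g \<noteq> e" by blast
      have "insert f (A - {e}) \<noteq> A" "insert f (A - {e}) \<noteq> B"
        "insert e (B - {f}) \<noteq> A" "insert e (B - {f}) \<noteq> B"
        using e f g by blast+
      with trees have
        "tree_vector (insert f (A - {e})) \<in> polytope_vertices ?P - {\<alpha>, \<beta>}"
        "tree_vector (insert e (B - {f})) \<in> polytope_vertices ?P - {\<alpha>, \<beta>}"
        unfolding polytope_vertices_spanning_tree A(2) B(2)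
        by (blast dest: iffD1[OF tree_vector_eq_iff])+
      moreover have "\<alpha> + \<beta> = tree_vector (insert f (A - {e})) + tree_vector (insert e (B - {f}))"
        unfolding A(2) B(2) using e f by (rule tree_vector_swap_sum)
      ultimately show ?thesis by blast
    qed
  qed
  moreover have "polytope ?P"
    unfolding spanning_tree_polytope_def by (rule polytope_convex_hull[OF finite_tree_vectors])
  ultimately show ?thesis unfolding rhombus_criterion_def by blast
qed

end
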